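(* Let $N\ge2$, let $\xi_1,\ldots,\xi_N$ be distinct nodes, let $W_N=\operatorname{diag}(w_1,\ldots,w_N)$ with all $w_i>0$, and let $\psi_0,\ldots,\psi_{N-1}$ be real-valued functions on $\{\xi_1,\ldots,\xi_N\}$. Put $\boldsymbol u_k=(\psi_k(\xi_1),\ldots,\psi_k(\xi_N))^\top$ and assume $\boldsymbol u_j^\top W_N\boldsymbol u_k=\nu_k\delta_{jk}$ with $\nu_k>0$ for $j,k=0,\ldots,N-1$. Let $\omega$ be a nonnegative measurable weight on $(-1,1)$, let $s_1,\ldots,s_N\subset(-1,1)$ be measurable cells with $0<\int_{s_i}\omega(x)\,dx<\infty$ for all $i$, and let $P_0,\ldots,P_{N-1}$ be real-valued functions integrable with respect to $\omega$ on each cell, with $P_0=1$. Put $$\boldsymbol c_k=\left(\int_{s_1}P_k\omega\,dx,\ldots,\int_{s_N}P_k\omega\,dx\right)^\top,\quad k=0,\ldots,N-1.$$ Fix $m\in\{1,\ldots,N-1\}$ and assume there exist real numbers $\eta_0\ne0$, $\eta_m$, and $\widehat a_k\neq0$ ($k=1,\ldots,N-1$) such that $$\boldsymbol c_0=\eta_0\boldsymbol u_0+\eta_m\boldsymbol u_m,\qquad \boldsymbol c_k=\widehat a_k\boldsymbol u_k,\quad k=1,\ldots,N-1.$$ Let $$\lambda_m=\frac{\boldsymbol c_0^\top W_N\boldsymbol c_m}{\boldsymbol c_0^\top W_N\boldsymbol c_0},\qquad \widehat P_m=P_m-\lambda_m,\qquad \widehat P_k=P_k\ \ (k\in\{0,\ldots,N-1\}\setminus\{m\}),$$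 and let $\hat M_N\in\mathbb R^{N\times N}$ be defined by $[\hat M_N]_{i,k+1}=\int_{s_i}\widehat P_k(x)\omega(x)\,dx$, $i=1,\ldots,N$, $k=0,\ldots,N-1$. Then $$\hat M_N^\top W_N\hat M_N=\operatorname{diag}(d_0,\ldots,d_{N-1}),$$ where $$d_0=\eta_0^2\nu_0+\eta_m^2\nu_m,\qquad d_m=\frac{\widehat a_m^2\,\nu_0\nu_m\,\eta_0^2}{\eta_0^2\nu_0+\eta_m^2\nu_m},\qquad d_k=\widehat a_k^2\nu_k,\quad k\in\{1,\ldots,N-1\}\setminus\{m\}.$$ In particular, $\hat M_N$ is nonsingular.
   Context: $\delta_{jk}$ is the Kronecker delta. *)

theory Defs
  imports "HOL-Analysis.Analysis" "Jordan_Normal_Form.Matrix"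
begin

text \<open>
  Nodes, weights and cells are indexed by \<open>1, \<dots>, N\<close>, whereas vectors and matrices of
  dimension \<open>N\<close> are indexed from \<open>0\<close>: row \<open>i\<close> of a vector or matrix belongs to index \<open>Suc i\<close>.
  Columns are indexed by \<open>k = 0, \<dots>, N - 1\<close> on both sides.
\<close>

definition diag_weight :: "nat \<Rightarrow> (nat \<Rightarrow> real) \<Rightarrow> real mat" where
  "diag_weight N w = mat_diag N (\<lambda>i. w (Suc i))"

definition node_vec :: "nat \<Rightarrow> (nat \<Rightarrow> 'a) \<Rightarrow> ('a \<Rightarrow> real) \<Rightarrow> real Matrix.vec" where
  "node_vec N \<xi> f = Matrix.vec N (\<lambda>i. f (\<xi> (Suc i)))"

definition cell_integral :: "(real \<Rightarrow> real) \<Rightarrow> real set \<Rightarrow> (real \<Rightarrow> real) \<Rightarrow> real" where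
  "cell_integral \<omega> S f = (LINT x:S|lebesgue. f x * \<omega> x)"

definition cell_vec ::
  "nat \<Rightarrow> (real \<Rightarrow> real) \<Rightarrow> (nat \<Rightarrow> real set) \<Rightarrow> (real \<Rightarrow> real) \<Rightarrow> real Matrix.vec" where
  "cell_vec N \<omega> s f = Matrix.vec N (\<lambda>i. cell_integral \<omega> (s (Suc i)) f)"

definition cell_matrix ::
  "nat \<Rightarrow> (real \<Rightarrow> real) \<Rightarrow> (nat \<Rightarrow> real set) \<Rightarrow> (nat \<Rightarrow> real \<Rightarrow> real) \<Rightarrow> real mat" where
  "cell_matrix N \<omega> s Q = Matrix.mat N N (\<lambda>(i, k). cell_integral \<omega> (s (Suc i)) (Q k))"

text \<open>The bilinear form \<open>x\<^sup>T W y\<close>.\<close>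

definition weighted_prod :: "real mat \<Rightarrow> real Matrix.vec \<Rightarrow> real Matrix.vec \<Rightarrow> real" where
  "weighted_prod W x y = scalar_prod x (W *\<^sub>v y)"

definition shift_coeff ::
  "nat \<Rightarrow> (nat \<Rightarrow> real) \<Rightarrow> (real \<Rightarrow> real) \<Rightarrow> (nat \<Rightarrow> real set) \<Rightarrow> (nat \<Rightarrow> real \<Rightarrow> real) \<Rightarrow> nat \<Rightarrow> real"
  where
  "shift_coeff N w \<omega> s P m =
     weighted_prod (diag_weight N w) (cell_vec N \<omega> s (P 0)) (cell_vec N \<omega> s (P m)) /
     weighted_prod (diag_weight N w) (cell_vec N \<omega> s (P 0)) (cell_vec N \<omega> s (P 0))"

definition shifted_basis ::
  "nat \<Rightarrow> (nat \<Rightarrow> real) \<Rightarrow> (real \<Rightarrow> real) \<Rightarrow> (nat \<Rightarrow> real set) \<Rightarrow> (nat \<Rightarrow> real \<Rightarrow> real) \<Rightarrow> nat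
     \<Rightarrow> nat \<Rightarrow> real \<Rightarrow> real" where
  "shifted_basis N w \<omega> s P m k =
     (if k = m then (\<lambda>x. P m x - shift_coeff N w \<omega> s P m) else P k)"

end

theory Submission
  imports Defs "Jordan_Normal_Form.Determinant"
begin

text \<open>
  The \<open>(i, j)\<close> entry of \<open>A\<^sup>T W A\<close> is the weighted product of columns \<open>i\<close> and \<open>j\<close> of \<open>A\<close>
  (\<open>gram_entry\<close>), so the claim says that the columns of the shifted cell matrix are
  \<open>W\<close>-orthogonal with squared norms \<open>d\<^sub>k\<close>. The cell vectors \<open>c\<^sub>k\<close> are multiples of the
  orthogonal vectors \<open>u\<^sub>k\<close>, with the single exception of \<open>c\<^sub>0\<close>, which also has a component
  along \<open>u\<^sub>m\<close>. The only pair of them that can fail to be orthogonal is therefore \<open>c\<^sub>0, c\<^sub>m\<close>.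
  Since \<open>P\<^sub>0 = 1\<close>, subtracting the constant \<open>\<lambda>\<^sub>m\<close> from \<open>P\<^sub>m\<close> replaces \<open>c\<^sub>m\<close> by
  \<open>c\<^sub>m - \<lambda>\<^sub>m c\<^sub>0\<close> (\<open>cell_vec_diff_const\<close>), and \<open>\<lambda>\<^sub>m\<close> is exactly the Gram--Schmidt
  coefficient that makes this vector orthogonal to \<open>c\<^sub>0\<close>. It stays in the span of \<open>u\<^sub>0\<close> and
  \<open>u\<^sub>m\<close>, hence stays orthogonal to all the other columns, and Pythagoras yields its norm.

  All \<open>d\<^sub>k\<close> are positive because the \<open>\<nu>\<^sub>k\<close> are and \<open>\<eta>\<^sub>0\<close> and the \<open>a\<^sub>k\<close> do not vanish, so that
  \<open>diag(1 / d\<^sub>k) A\<^sup>T W\<close> is an inverse of \<open>A\<close> (\<open>invertible_mat_of_gram_diag\<close>).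
\<close>

lemma weighted_prod_diag_weight:
  assumes "y \<in> carrier_vec N"
  shows "weighted_prod (diag_weight N w) x y = (\<Sum>i<N. w (Suc i) * (x $ i * y $ i))"
proof -
  have "diag_weight N w *\<^sub>v y = Matrix.vec N (\<lambda>i. w (Suc i) * y $ i)"
  proof (rule eq_vecI)
    fix i
    assume "i < dim_vec (Matrix.vec N (\<lambda>i. w (Suc i) * y $ i))"
    then have "i < N" by simp
    then have "(diag_weight N w *\<^sub>v y) $ i =
        (\<Sum>j<N. (if i = j then w (Suc j) else 0) * y $ j)"
      using assms
      by (auto simp: diag_weight_def mat_diag_def scalar_prod_def atLeast0LessThan intro!: sum.cong)
    also have "\<dots> = (\<Sum>j<N. if j = i then w (Suc i) * y $ i else 0)"
      by (rule sum.cong) auto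
    finally show "(diag_weight N w *\<^sub>v y) $ i = Matrix.vec N (\<lambda>i. w (Suc i) * y $ i) $ i"
      using \<open>i < N\<close> by simp
  qed (simp add: diag_weight_def mat_diag_def)
  then show ?thesis
    by (auto simp: weighted_prod_def scalar_prod_def atLeast0LessThan intro!: sum.cong)
qed

lemma weighted_prod_commute:
  assumes "x \<in> carrier_vec N" "y \<in> carrier_vec N"
  shows "weighted_prod (diag_weight N w) x y = weighted_prod (diag_weight N w) y x"
  using assms by (simp add: weighted_prod_diag_weight mult.commute)

lemma weighted_prod_add_left:
  assumes "x \<in> carrier_vec N" "y \<in> carrier_vec N" "z \<in> carrier_vec N"
  shows "weighted_prod (diag_weight N w) (x + y) z =
           weighted_prod (diag_weight N w) x z + weighted_prod (diag_weight N w) y z"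
  using assms
  by (simp add: weighted_prod_diag_weight sum.distrib[symmetric] algebra_simps)

lemma weighted_prod_add_right:
  assumes "x \<in> carrier_vec N" "y \<in> carrier_vec N" "z \<in> carrier_vec N"
  shows "weighted_prod (diag_weight N w) z (x + y) =
           weighted_prod (diag_weight N w) z x + weighted_prod (diag_weight N w) z y"
  using assms
  by (simp add: weighted_prod_diag_weight sum.distrib[symmetric] algebra_simps)

lemma weighted_prod_smult_left:
  assumes "x \<in> carrier_vec N" "z \<in> carrier_vec N"
  shows "weighted_prod (diag_weight N w) (a \<cdot>\<^sub>v x) z = a * weighted_prod (diag_weight N w) x z"
  using assms
  by (simp add: weighted_prod_diag_weight sum_distrib_left algebra_simps)

lemma weighted_prod_smult_right:
  assumes "x \<in> carrier_vec N" "z \<in> carrier_vec N"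
  shows "weighted_prod (diag_weight N w) z (a \<cdot>\<^sub>v x) = a * weighted_prod (diag_weight N w) z x"
  using assms
  by (simp add: weighted_prod_diag_weight sum_distrib_left algebra_simps)

lemmas weighted_prod_bilinear =
  weighted_prod_add_left weighted_prod_add_right weighted_prod_smult_left weighted_prod_smult_right

lemma gram_entry:
  assumes A: "A \<in> carrier_mat N N" and W: "W \<in> carrier_mat N N" and "i < N" "j < N"
  shows "(transpose_mat A * W * A) $$ (i, j) = weighted_prod W (col A i) (col A j)"
proof -
  have "transpose_mat A * W * A = transpose_mat A * (W * A)"
    using A W by (intro assoc_mult_mat) auto
  moreover have "col (W * A) j = W *\<^sub>v col A j"
    using assms by auto
  ultimately show ?thesis
    using assms by (simp add: weighted_prod_def)
qed

lemma col_cell_matrix: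
  assumes "k < N"
  shows "col (cell_matrix N \<omega> s Q) k = cell_vec N \<omega> s (Q k)"
  using assms by (intro eq_vecI) (auto simp: cell_matrix_def cell_vec_def)

text \<open>On the cells the constant \<open>c\<close> coincides with \<open>c * g\<close>, so linearity of the integral turns the
  shift of a function by a constant into a linear operation on cell vectors.\<close>

lemma cell_vec_diff_const:
  assumes f: "\<And>i. i \<in> {1..N} \<Longrightarrow> set_integrable lebesgue (s i) (\<lambda>x. f x * \<omega> x)"
    and g: "\<And>i. i \<in> {1..N} \<Longrightarrow> set_integrable lebesgue (s i) (\<lambda>x. g x * \<omega> x)"
    and s: "\<And>i. i \<in> {1..N} \<Longrightarrow> s i \<in> sets lebesgue"
    and one: "\<And>i x. i \<in> {1..N} \<Longrightarrow> x \<in> s i \<Longrightarrow> g x = 1"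
  shows "cell_vec N \<omega> s (\<lambda>x. f x - c) = cell_vec N \<omega> s f + (- c) \<cdot>\<^sub>v cell_vec N \<omega> s g"
proof (intro eq_vecI)
  fix i
  assume "i < dim_vec (cell_vec N \<omega> s f + (- c) \<cdot>\<^sub>v cell_vec N \<omega> s g)"
  then have i: "i < N" and i': "Suc i \<in> {1..N}"
    by (auto simp: cell_vec_def)
  have "cell_integral \<omega> (s (Suc i)) (\<lambda>x. f x - c) =
          (LINT x:s (Suc i)|lebesgue. f x * \<omega> x - c * (g x * \<omega> x))"
    unfolding cell_integral_def using s[OF i'] one[OF i']
    by (intro set_lebesgue_integral_cong) (auto simp: algebra_simps)
  also have "\<dots> = cell_integral \<omega> (s (Suc i)) f - c * cell_integral \<omega> (s (Suc i)) g"
    unfolding cell_integral_def using f[OF i'] g[OF i'] by (subst set_integral_diff) auto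
  finally show "cell_vec N \<omega> s (\<lambda>x. f x - c) $ i =
      (cell_vec N \<omega> s f + (- c) \<cdot>\<^sub>v cell_vec N \<omega> s g) $ i"
    using i by (simp add: cell_vec_def)
qed (simp add: cell_vec_def)

text \<open>Rescaling the rows of \<open>A\<^sup>T W\<close> by the reciprocals of \<open>d\<close> gives a left inverse of \<open>A\<close>,
  and over a field a left inverse of a square matrix is a right inverse as well.\<close>

lemma invertible_mat_of_gram_diag:
  fixes A W :: "real mat"
  assumes A: "A \<in> carrier_mat N N" and W: "W \<in> carrier_mat N N"
    and gram: "transpose_mat A * W * A = mat_diag N d"
    and d: "\<And>k. k < N \<Longrightarrow> d k \<noteq> 0"
  shows "invertible_mat A"
proof -
  let ?L = "mat_diag N (\<lambda>k. 1 / d k) * (transpose_mat A * W)"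
  have L: "?L \<in> carrier_mat N N"
    using A W by (meson mat_diag_dim mult_carrier_mat transpose_carrier_mat)
  have "?L * A = mat_diag N (\<lambda>k. 1 / d k) * mat_diag N d"
    using A W by (subst gram[symmetric], intro assoc_mult_mat[of _ N N _ N _ N]) auto
  also have "\<dots> = 1\<^sub>m N"
    unfolding mat_diag_diag using d by (intro eq_matI) (auto simp: mat_diag_def)
  finally have LA: "?L * A = 1\<^sub>m N" .
  have "A * ?L = 1\<^sub>m N"
    using mat_mult_left_right_inverse[OF L A LA] .
  moreover have "dim_row ?L = N"
    using L by blast
  ultimately show ?thesis
    using A LA unfolding invertible_mat_def inverts_mat_def by (auto intro!: exI[of _ ?L])
qed

theorem theorem5:
  fixes N m :: nat
    and \<xi> :: "nat \<Rightarrow> 'a"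
    and w :: "nat \<Rightarrow> real"
    and \<psi> :: "nat \<Rightarrow> 'a \<Rightarrow> real"
    and \<nu> :: "nat \<Rightarrow> real"
    and \<omega> :: "real \<Rightarrow> real"
    and s :: "nat \<Rightarrow> real set"
    and P :: "nat \<Rightarrow> real \<Rightarrow> real"
    and \<eta>\<^sub>0 \<eta>\<^sub>m :: real
    and a :: "nat \<Rightarrow> real"
  assumes "N \<ge> 2"
    and "inj_on \<xi> {1..N}"
    and "\<And>i. i \<in> {1..N} \<Longrightarrow> w i > 0"
    and "\<And>k. k \<in> {0..N - 1} \<Longrightarrow> \<nu> k > 0"
    and "\<And>j k. j \<in> {0..N - 1} \<Longrightarrow> k \<in> {0..N - 1} \<Longrightarrow>
           weighted_prod (diag_weight N w) (node_vec N \<xi> (\<psi> j)) (node_vec N \<xi> (\<psi> k)) =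
             (if j = k then \<nu> k else 0)"
    and "\<omega> \<in> borel_measurable (lebesgue_on {-1<..<1})"
    and "\<And>x. x \<in> {-1<..<1} \<Longrightarrow> \<omega> x \<ge> 0"
    and "\<And>i. i \<in> {1..N} \<Longrightarrow> s i \<in> sets lebesgue \<and> s i \<subseteq> {-1<..<1}"
    and "\<And>i. i \<in> {1..N} \<Longrightarrow>
           0 < (\<integral>\<^sup>+x\<in>s i. ennreal (\<omega> x)\<partial>lebesgue) \<and> (\<integral>\<^sup>+x\<in>s i. ennreal (\<omega> x)\<partial>lebesgue) < \<infinity>"
    and "\<And>i k. i \<in> {1..N} \<Longrightarrow> k \<in> {0..N - 1} \<Longrightarrow>
           set_integrable lebesgue (s i) (\<lambda>x. P k x * \<omega> x)"
    and "\<And>x. x \<in> {-1<..<1} \<Longrightarrow> P 0 x = 1"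
    and "m \<in> {1..N - 1}"
    and "\<eta>\<^sub>0 \<noteq> 0"
    and "\<And>k. k \<in> {1..N - 1} \<Longrightarrow> a k \<noteq> 0"
    and "cell_vec N \<omega> s (P 0) =
           \<eta>\<^sub>0 \<cdot>\<^sub>v node_vec N \<xi> (\<psi> 0) + \<eta>\<^sub>m \<cdot>\<^sub>v node_vec N \<xi> (\<psi> m)"
    and "\<And>k. k \<in> {1..N - 1} \<Longrightarrow> cell_vec N \<omega> s (P k) = a k \<cdot>\<^sub>v node_vec N \<xi> (\<psi> k)"
  shows "transpose_mat (cell_matrix N \<omega> s (shifted_basis N w \<omega> s P m)) * diag_weight N w *
           cell_matrix N \<omega> s (shifted_basis N w \<omega> s P m) =
         mat_diag N (\<lambda>k.
           if k = 0 then \<eta>\<^sub>0\<^sup>2 * \<nu> 0 + \<eta>\<^sub>m\<^sup>2 * \<nu> m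
           else if k = m then (a m)\<^sup>2 * \<nu> 0 * \<nu> m * \<eta>\<^sub>0\<^sup>2 / (\<eta>\<^sub>0\<^sup>2 * \<nu> 0 + \<eta>\<^sub>m\<^sup>2 * \<nu> m)
           else (a k)\<^sup>2 * \<nu> k)
         \<and> invertible_mat (cell_matrix N \<omega> s (shifted_basis N w \<omega> s P m))"
proof -
  let ?W = "diag_weight N w"
  let ?B = "weighted_prod ?W"
  let ?Q = "shifted_basis N w \<omega> s P m"
  let ?A = "cell_matrix N \<omega> s ?Q"
  define u where "u k = node_vec N \<xi> (\<psi> k)" for k
  define c where "c k = cell_vec N \<omega> s (P k)" for k
  define d\<^sub>0 where "d\<^sub>0 = \<eta>\<^sub>0\<^sup>2 * \<nu> 0 + \<eta>\<^sub>m\<^sup>2 * \<nu> m"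
  define l where "l = shift_coeff N w \<omega> s P m"
  define d where "d = (\<lambda>k. if k = 0 then d\<^sub>0
      else if k = m then (a m)\<^sup>2 * \<nu> 0 * \<nu> m * \<eta>\<^sub>0\<^sup>2 / d\<^sub>0 else (a k)\<^sup>2 * \<nu> k)"
  have m: "0 < m" "m < N"
    using assms(1,12) by auto
  have u[simp]: "u k \<in> carrier_vec N" for k
    by (simp add: u_def node_vec_def)
  have c[simp]: "c k \<in> carrier_vec N" for k
    by (simp add: c_def cell_vec_def)
  have W: "?W \<in> carrier_mat N N"
    by (simp add: diag_weight_def)
  have A: "?A \<in> carrier_mat N N"
    by (simp add: cell_matrix_def)
  have nu: "\<nu> k > 0" if "k < N" for k
    using assms(4) that by auto
  have orth: "?B (u j) (u k) = (if j = k then \<nu> k else 0)" if "j < N" "k < N" for j k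
    using assms(5) that by (auto simp: u_def)
  have c0: "c 0 = \<eta>\<^sub>0 \<cdot>\<^sub>v u 0 + \<eta>\<^sub>m \<cdot>\<^sub>v u m"
    using assms(15) by (simp add: c_def u_def)
  have ck: "c k = a k \<cdot>\<^sub>v u k" if "0 < k" "k < N" for k
    using assms(16) that by (auto simp: c_def u_def)
  have d0: "d\<^sub>0 > 0"
    unfolding d\<^sub>0_def using nu[of 0] nu[of m] m assms(13) by (simp add: add_pos_nonneg)

  have c0c0: "?B (c 0) (c 0) = d\<^sub>0"
    unfolding c0 using m
    by (simp add: weighted_prod_bilinear orth d\<^sub>0_def power2_eq_square)
  have c0ck: "?B (c 0) (c k) = (if k = m then a m * \<eta>\<^sub>m * \<nu> m else 0)" if "0 < k" "k < N" for k
    unfolding c0 ck[OF that] using m that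
    by (simp add: weighted_prod_bilinear orth)
  have cjck: "?B (c j) (c k) = (if j = k then (a k)\<^sup>2 * \<nu> k else 0)"
    if "0 < j" "j < N" "0 < k" "k < N" for j k
    using that
    by (simp add: ck weighted_prod_bilinear orth power2_eq_square)
  have ckc0: "?B (c k) (c 0) = (if k = m then a m * \<eta>\<^sub>m * \<nu> m else 0)" if "0 < k" "k < N" for k
    using c0ck[OF that] by (subst weighted_prod_commute) auto
  have l: "l = a m * \<eta>\<^sub>m * \<nu> m / d\<^sub>0"
    using c0ck[OF m] c0c0 by (simp add: l_def shift_coeff_def c_def)

  define h where "h = c m + (- l) \<cdot>\<^sub>v c 0"
  have h[simp]: "h \<in> carrier_vec N"
    by (simp add: h_def)
  have cm_hat: "cell_vec N \<omega> s (\<lambda>x. P m x - l) = h"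
    unfolding h_def c_def
  proof (rule cell_vec_diff_const)
    show "P 0 x = 1" if "i \<in> {1..N}" "x \<in> s i" for i x
      using assms(8)[OF that(1)] assms(11) that(2) by blast
  qed (use assms(8,10) m in auto)
  have col: "col ?A k = (if k = m then h else c k)" if "k < N" for k
    using cm_hat by (simp add: col_cell_matrix[OF that] shifted_basis_def l_def c_def)

  \<comment> \<open>The shift is the Gram--Schmidt step: it removes the component along \<open>c 0\<close>.\<close>
  have c0h: "?B (c 0) h = 0"
    unfolding h_def using m d0 by (simp add: weighted_prod_bilinear c0ck c0c0 l)
  have ckh: "?B (c k) h = 0" if "0 < k" "k < N" "k \<noteq> m" for k
    unfolding h_def using m that by (simp add: weighted_prod_bilinear cjck ckc0)
  have ch: "?B (c k) h = 0" if "k < N" "k \<noteq> m" for k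
    using c0h ckh that by (cases "k = 0") auto
  have hc: "?B h (c k) = 0" if "k < N" "k \<noteq> m" for k
    using ch[OF that] by (subst weighted_prod_commute) auto
  have hh: "?B h h = d m"
  proof -
    \<comment> \<open>By orthogonality to \<open>c 0\<close>, only the \<open>c m\<close> part of the left factor contributes.\<close>
    have "?B h h = ?B (c m) h"
      using c0h weighted_prod_add_left[of "c m" N "(- l) \<cdot>\<^sub>v c 0" h w]
      by (simp add: weighted_prod_smult_left flip: h_def)
    also have "\<dots> = (a m)\<^sup>2 * \<nu> m - l * (a m * \<eta>\<^sub>m * \<nu> m)"
      unfolding h_def using m by (simp add: weighted_prod_bilinear cjck ckc0)
    also have "\<dots> = (a m)\<^sup>2 * \<nu> m * (d\<^sub>0 - \<eta>\<^sub>m\<^sup>2 * \<nu> m) / d\<^sub>0"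
      using d0 by (simp add: l field_simps power2_eq_square)
    also have "\<dots> = d m"
      using m by (simp add: d_def d\<^sub>0_def algebra_simps)
    finally show ?thesis .
  qed

  have gram: "transpose_mat ?A * ?W * ?A = mat_diag N d"
  proof (rule eq_matI)
    fix i j
    assume "i < dim_row (mat_diag N d)" "j < dim_col (mat_diag N d)"
    then have ij: "i < N" "j < N"
      by (auto simp: mat_diag_def)
    have "?B (col ?A i) (col ?A j) = (if i = j then d j else 0)"
      using ij m hh hc ch c0c0 c0ck ckc0 cjck
      by (cases "i = 0"; cases "j = 0") (auto simp: col d_def)
    then show "(transpose_mat ?A * ?W * ?A) $$ (i, j) = mat_diag N d $$ (i, j)"
      using ij by (simp add: gram_entry[OF A W] mat_diag_def)
  qed (use A W in \<open>auto simp: mat_diag_def\<close>)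
  moreover have "invertible_mat ?A"
  proof (rule invertible_mat_of_gram_diag[OF A W gram])
    show "d k \<noteq> 0" if "k < N" for k
      using that d0 m nu[OF that] nu[of 0] nu[of m] assms(13,14) by (auto simp: d_def)
  qed
  ultimately show ?thesis
    unfolding d_def d\<^sub>0_def by blast
qed

end
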